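(* Let $(\mathcal{A},m)$ be a multiarrangement, and let $\mathcal{A}\,\|\,m$ be its polarization. Then there is a pullback diagram between the respective Milnor covers, $$\begin{array}{ccc} F(\mathcal{A},m)&\longrightarrow&F(\mathcal{A}\,\|\,m)\\ \downarrow&&\downarrow\\ U(\mathcal{A})&\xrightarrow{\ j\ }&U(\mathcal{A}\,\|\,m),\end{array}$$ where $j$ is the map given by choosing a base point in each space $P_{m_H}$, for $H\in\mathcal{A}$.
   Context: Arrangements are finite sets of linear hyperplanes in complex vector spaces. For an arrangement $\mathcal{A}$ in $\mathbb{C}^\ell$ with linear forms $f_H$, $\ker f_H=H$, $M(\mathcal{A})$ is its complement and $U(\mathcal{A})=\mathbb{P}M(\mathcal{A})$ its image in $\mathbb{P}^{\ell-1}$. A multiarrangement $(\mathcal{A},m)$ is a (simple) arrangement with positive integers $m_H$, $H\in\mathcal{A}$, assumed to satisfy $\gcd(m_H)=1$. Its Milnor fiber is $F(\mathcal{A},m)=\{\prod_Hf_H^{m_H}=1\}\subset\mathbb{C}^\ell$; the map $z\mapsto[z]$ is a regular cyclic cover $F(\mathcal{A},m)\to U(\mathcal{A})$ with group $\mathbb{Z}_N$, $N=\sum_Hm_H$ (the Milnor cover). For a simple arrangement $\mathcal{B}$, $F(\mathcal{B})$ is the Milnor fiber with all multiplicities 1. Parallel connection: for arrangements $\mathcal{A}_1$ in $V_1$, $\mathcal{A}_2$ in $V_2$ with forms $f_K$, $g_K$, and $H_1\in\mathcal{A}_1$, $H_2\in\mathcal{A}_2$, the parallel connection is the arrangement in $\{(x,y)\in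 V_1\times V_2:f_{H_1}(x)=g_{H_2}(y)\}$ defined by $f_{H_1}\prod_{K\ne H_1}f_K\prod_{K\ne H_2}g_K$. There is a diffeomorphism $\mathbb{P}M(\mathcal{A}_1)\times\mathbb{P}M(\mathcal{A}_2)\to\mathbb{P}M(\text{parallel connection})$, $([v],[w])\mapsto[(g_{H_2}(w)v,f_{H_1}(v)w)]$, with inverse $[(v,w)]\mapsto([v],[w])$. Let $\mathcal{P}_1$ be one point in $\mathbb{C}^1$ and, for $k\ge2$, let $\mathcal{P}_k$ be a central arrangement of $k$ distinct lines $L_1,\dots,L_k$ in $\mathbb{C}^2$ with basepoint $L_1$; write $P_k=\mathbb{P}M(\mathcal{P}_k)$ (so $P_1$ is a point and $P_k\cong\mathbb{C}\setminus\{k-1\text{ points}\}$ for $k\ge2$). The polarization $\mathcal{A}\,\|\,m$ is obtained from $\mathcal{A}$ by performing, successively for each $H\in\mathcal{A}$, a parallel connection with $\mathcal{P}_{m_H}$ identifying $H$ with the basepoint $L_1$; it is a simple arrangement of $N$ hyperplanes. At the step of this construction corresponding to $H\in\mathcal{A}$, let $\mathcal{C}$ be the arrangement obtained so far and $\mathcal{C}'$ its parallel connection with $\mathcal{P}_{m_H}$, let $f_H$ also denote the form defining the hyperplane of $\mathcal{C}$ coming from $H$, and let $g_{L_1}$ be the form defining the basepoint of $\mathcal{P}_{m_H}$; then $([v],[w])\mapsto[(g_{L_1}(w)v,f_H(v)w)]$ is a diffeomorphism $\mathbb{P}M(\mathcal{C})\times P_{m_H}\to\mathbb{P}M(\mathcal{C}')$.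 Composing these diffeomorphisms over all $H\in\mathcal{A}$ (each extended by the identity on the remaining factors) gives a homeomorphism $\theta\colon U(\mathcal{A})\times\prod_{H\in\mathcal{A}}P_{m_H}\to U(\mathcal{A}\,\|\,m)$; the map $j$ is $u\mapsto\theta(u,b)$ for a chosen point $b=(b_H)\in\prod_HP_{m_H}$. *)

theory Defs
  imports "HOL-Analysis.Analysis" "HOL-Library.Function_Algebras"
begin

section \<open>Complex vector spaces\<close>

class complex_vector = ab_group_add +
  fixes scaleC :: "complex \<Rightarrow> 'a \<Rightarrow> 'a"  (infixr \<open>*\<^sub>C\<close> 75)
  assumes scaleC_add_right: "a *\<^sub>C (x + y) = a *\<^sub>C x + a *\<^sub>C y"
    and scaleC_add_left: "(a + b) *\<^sub>C x = a *\<^sub>C x + b *\<^sub>C x"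
    and scaleC_scaleC: "a *\<^sub>C b *\<^sub>C x = (a * b) *\<^sub>C x"
    and scaleC_one: "1 *\<^sub>C x = x"

global_interpretation complex_vector: vector_space "scaleC :: complex \<Rightarrow> 'a \<Rightarrow> 'a::complex_vector"
  by unfold_locales (simp_all add: scaleC_add_right scaleC_add_left scaleC_scaleC scaleC_one)

instantiation complex :: complex_vector
begin
definition scaleC_complex_def: "a *\<^sub>C (x::complex) = a * x"
instance by standard (simp_all add: scaleC_complex_def algebra_simps)
end

instantiation vec :: (complex_vector, finite) complex_vector
begin
definition scaleC_vec_def: "a *\<^sub>C (x :: 'a ^ 'b) = (\<chi> i. a *\<^sub>C (x $ i))"
instance
  by standard
    (simp_all add: scaleC_vec_def vec_eq_iff scaleC_add_right scaleC_add_left scaleC_scaleC scaleC_one)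
end

instantiation prod :: (complex_vector, complex_vector) complex_vector
begin
definition scaleC_prod_def: "a *\<^sub>C (x :: 'a \<times> 'b) = (a *\<^sub>C fst x, a *\<^sub>C snd x)"
instance
  by standard
    (simp_all add: scaleC_prod_def prod_eq_iff scaleC_add_right scaleC_add_left scaleC_scaleC scaleC_one)
end

instantiation "fun" :: (type, complex_vector) complex_vector
begin
definition scaleC_fun_def: "a *\<^sub>C (x :: 'a \<Rightarrow> 'b) = (\<lambda>i. a *\<^sub>C x i)"
instance
  by standard
    (simp_all add: scaleC_fun_def fun_eq_iff scaleC_add_right scaleC_add_left scaleC_scaleC scaleC_one)
end

section \<open>Arrangements and their complements\<close>

text \<open>
  An arrangement is a labelled family of linear forms. The vector space in which it lives is the
  subspace \<open>ambient\<close> of the type \<open>'v\<close>; only the restrictions of the forms to \<open>ambient\<close> matter.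
\<close>

record ('h, 'v) arrangement =
  ambient :: "'v set"
  hyps :: "'h set"
  form :: "'h \<Rightarrow> 'v \<Rightarrow> complex"

definition hyperplane :: "('h, 'v) arrangement \<Rightarrow> 'h \<Rightarrow> 'v set" where
  "hyperplane A H = {v \<in> ambient A. form A H v = 0}"

text \<open>Injectivity of \<^const>\<open>hyperplane\<close> says that the arrangement is simple.\<close>

definition is_arrangement :: "('h, 'v::complex_vector) arrangement \<Rightarrow> bool" where
  "is_arrangement A \<longleftrightarrow>
     (\<exists>B. finite B \<and> complex_vector.span B = ambient A) \<and>
     finite (hyps A) \<and>
     (\<forall>H\<in>hyps A. Vector_Spaces.linear (*\<^sub>C) (*) (form A H) \<and> hyperplane A H \<noteq> ambient A) \<and>
     inj_on (hyperplane A) (hyps A)"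

definition is_multiarrangement ::
  "('h, 'v::complex_vector) arrangement \<Rightarrow> ('h \<Rightarrow> nat) \<Rightarrow> bool" where
  "is_multiarrangement A m \<longleftrightarrow>
     is_arrangement A \<and> (\<forall>H\<in>hyps A. 0 < m H) \<and> Gcd (m ` hyps A) = 1"

definition compl_arr :: "('h, 'v) arrangement \<Rightarrow> 'v set" where
  "compl_arr A = {v \<in> ambient A. \<forall>H\<in>hyps A. form A H v \<noteq> 0}"

definition proj :: "'v::complex_vector \<Rightarrow> 'v set" where
  "proj v = {c *\<^sub>C v | c. c \<noteq> 0}"

text \<open>The projective space of a subspace \<open>V\<close>, with the quotient topology from \<open>V - {0}\<close>.\<close>

definition proj_space :: "'v::{complex_vector,topological_space} set \<Rightarrow> 'v set topology" where
  "proj_space V = topology (\<lambda>S. S \<subseteq> proj ` (V - {0}) \<and>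
     openin (top_of_set (V - {0})) {v \<in> V - {0}. proj v \<in> S})"

lemma openin_proj_space:
  "openin (proj_space V) S \<longleftrightarrow> S \<subseteq> proj ` (V - {0}) \<and>
     openin (top_of_set (V - {0})) {v \<in> V - {0}. proj v \<in> S}"
proof -
  have "istopology (\<lambda>S. S \<subseteq> proj ` (V - {0}) \<and>
     openin (top_of_set (V - {0})) {v \<in> V - {0}. proj v \<in> S})"
    unfolding istopology_def
  proof (intro conjI allI impI; (elim conjE)?)
    fix S T assume "openin (top_of_set (V - {0})) {v \<in> V - {0}. proj v \<in> S}"
      "openin (top_of_set (V - {0})) {v \<in> V - {0}. proj v \<in> T}"
    then have "openin (top_of_set (V - {0}))
        ({v \<in> V - {0}. proj v \<in> S} \<inter> {v \<in> V - {0}. proj v \<in> T})" by (rule openin_Int)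
    then show "openin (top_of_set (V - {0})) {v \<in> V - {0}. proj v \<in> S \<inter> T}"
      by (rule back_subst[of "openin _"]) auto
  next
    fix \<K> assume *: "\<forall>K\<in>\<K>. K \<subseteq> proj ` (V - {0}) \<and>
      openin (top_of_set (V - {0})) {v \<in> V - {0}. proj v \<in> K}"
    then have "openin (top_of_set (V - {0})) (\<Union>K\<in>\<K>. {v \<in> V - {0}. proj v \<in> K})" by blast
    then show "openin (top_of_set (V - {0})) {v \<in> V - {0}. proj v \<in> \<Union>\<K>}"
      by (rule back_subst[of "openin _"]) auto
    show "\<Union>\<K> \<subseteq> proj ` (V - {0})" using * by blast
  qed auto
  then show ?thesis unfolding proj_space_def by (simp add: topology_inverse')
qed

lemma quotient_map_proj: "quotient_map (top_of_set (V - {0})) (proj_space V) proj"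
proof -
  have "{v \<in> V - {0}. proj v \<in> proj ` (V - {0})} = V - {0}" by auto
  then have "openin (proj_space V) (proj ` (V - {0}))"
    unfolding openin_proj_space by (simp only: openin_subtopology_self) simp
  moreover have "S \<subseteq> proj ` (V - {0})" if "openin (proj_space V) S" for S
    using that openin_proj_space by blast
  ultimately have "topspace (proj_space V) = proj ` (V - {0})"
    by (meson openin_subset openin_topspace subset_antisym)
  then show ?thesis by (auto simp: quotient_map_def openin_proj_space)
qed

definition proj_compl ::
  "('h, 'v::{complex_vector,topological_space}) arrangement \<Rightarrow> 'v set topology" where
  "proj_compl A = subtopology (proj_space (ambient A)) (proj ` compl_arr A)"

section \<open>Milnor fibers\<close>

definition milnor_fiber :: "('h, 'v) arrangement \<Rightarrow> ('h \<Rightarrow> nat) \<Rightarrow> 'v set" where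
  "milnor_fiber A m = {v \<in> ambient A. (\<Prod>H\<in>hyps A. form A H v ^ m H) = 1}"

section \<open>Parallel connections\<close>

definition parallel_connection ::
  "('h, 'v) arrangement \<Rightarrow> 'h \<Rightarrow> ('k, 'w) arrangement \<Rightarrow> 'k \<Rightarrow> ('h + 'k, 'v \<times> 'w) arrangement" where
  "parallel_connection A H B K =
     \<lparr>ambient = {(x, y). x \<in> ambient A \<and> y \<in> ambient B \<and> form A H x = form B K y},
      hyps = Inl ` hyps A \<union> Inr ` (hyps B - {K}),
      form = (\<lambda>L (x, y). case L of Inl i \<Rightarrow> form A i x | Inr j \<Rightarrow> form B j y)\<rparr>"

text \<open>
  The map \<open>([v], [w]) \<mapsto> [(g(w) v, f(v) w)]\<close>. Points of projective space are classes of
  vectors, and the union runs over all representatives; it is a single class by the lemma below.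
\<close>

definition pc_map ::
  "('v::complex_vector \<Rightarrow> complex) \<Rightarrow> ('w::complex_vector \<Rightarrow> complex) \<Rightarrow> 'v set \<Rightarrow> 'w set \<Rightarrow> ('v \<times> 'w) set"
  where "pc_map f g p q = (\<Union>v\<in>p. \<Union>w\<in>q. proj (g w *\<^sub>C v, f v *\<^sub>C w))"

lemma pc_map_proj:
  assumes f: "\<And>c. f (c *\<^sub>C v) = c * f v" and g: "\<And>c. g (c *\<^sub>C w) = c * g w"
  shows "pc_map f g (proj v) (proj w) = proj (g w *\<^sub>C v, f v *\<^sub>C w)"
proof -
  have "proj (g (d *\<^sub>C w) *\<^sub>C c *\<^sub>C v, f (c *\<^sub>C v) *\<^sub>C d *\<^sub>C w) = proj (g w *\<^sub>C v, f v *\<^sub>C w)"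
    if "c \<noteq> 0" "d \<noteq> 0" for c d
  proof -
    have "(g (d *\<^sub>C w) *\<^sub>C c *\<^sub>C v, f (c *\<^sub>C v) *\<^sub>C d *\<^sub>C w) = (c * d) *\<^sub>C (g w *\<^sub>C v, f v *\<^sub>C w)"
      by (simp add: f g scaleC_prod_def scaleC_scaleC mult_ac)
    moreover have "proj (e *\<^sub>C x) = proj x" if "e \<noteq> 0" for e and x :: "'a \<times> 'b"
    proof -
      have "\<exists>c'. c *\<^sub>C x = c' *\<^sub>C e *\<^sub>C x \<and> c' \<noteq> 0" if "c \<noteq> 0" for c
        using that \<open>e \<noteq> 0\<close> by (intro exI[of _ "c / e"]) (simp add: scaleC_scaleC)
      moreover have "\<exists>c'. c *\<^sub>C e *\<^sub>C x = c' *\<^sub>C x \<and> c' \<noteq> 0" if "c \<noteq> 0" for c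
        using that \<open>e \<noteq> 0\<close> by (intro exI[of _ "c * e"]) (simp add: scaleC_scaleC)
      ultimately show ?thesis unfolding proj_def by blast
    qed
    ultimately show ?thesis using that by simp
  qed
  moreover have "v \<in> proj v" "w \<in> proj w"
    unfolding proj_def by (auto intro!: exI[of _ 1] simp: scaleC_one)
  ultimately show ?thesis unfolding pc_map_def by (auto simp: proj_def[of v] proj_def[of w])
qed

section \<open>Polarization\<close>

text \<open>Relabelling along \<open>\<sigma>\<close> and transport along an injective linear map \<open>\<tau>\<close>.\<close>

definition transport ::
  "('h \<Rightarrow> 'k) \<Rightarrow> ('v \<Rightarrow> 'w) \<Rightarrow> ('h, 'v) arrangement \<Rightarrow> ('k, 'w) arrangement" where
  "transport \<sigma> \<tau> A =
     \<lparr>ambient = \<tau> ` ambient A,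
      hyps = \<sigma> ` hyps A,
      form = (\<lambda>K x. form A (inv_into (hyps A) \<sigma> K) (inv \<tau> x))\<rparr>"

text \<open>
  \<open>pencil k g\<close> is the arrangement of \<open>k\<close> distinct lines in the plane, with basepoint the line
  labelled \<open>1\<close>. For \<open>k = 1\<close> it is one point in a line, realized as the first coordinate axis.
\<close>

definition pencil :: "nat \<Rightarrow> (nat \<Rightarrow> complex \<times> complex \<Rightarrow> complex) \<Rightarrow> (nat, complex \<times> complex) arrangement" where
  "pencil k g =
     \<lparr>ambient = (if k = 1 then UNIV \<times> {0} else UNIV), hyps = {1..k}, form = g\<rparr>"

text \<open>
  Each parallel connection enlarges the surrounding vector space by a factor \<open>'w\<close>. To iterate
  within one type, the intermediate arrangements are placed in \<open>'v \<times> (nat \<Rightarrow> 'w)\<close>, starting from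
  \<open>'v \<times> 0\<close>; \<open>push\<close> is a linear homeomorphism that shifts the used slots and puts
  the new factor into slot \<open>0\<close>. The hyperplane coming from the original \<open>H\<close> is labelled
  \<open>(H, 1)\<close>, and the one coming from the \<open>i\<close>-th line attached at \<open>H\<close> is labelled \<open>(H, i)\<close>.
\<close>

definition start :: "'v \<Rightarrow> 'v \<times> (nat \<Rightarrow> 'w::zero)" where
  "start v = (v, \<lambda>_. 0)"

definition push :: "('v \<times> (nat \<Rightarrow> 'w)) \<times> 'w \<Rightarrow> 'v \<times> (nat \<Rightarrow> 'w)" where
  "push = (\<lambda>((v, s), w). (v, case_nat w s))"

definition polarization_start ::
  "('h, 'v) arrangement \<Rightarrow> ('h \<times> nat, 'v \<times> (nat \<Rightarrow> 'w::zero)) arrangement" where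
  "polarization_start A = transport (\<lambda>H. (H, 1)) start A"

definition polarization_step ::
  "'h \<Rightarrow> (nat, 'w) arrangement \<Rightarrow> ('h \<times> nat, 'v \<times> (nat \<Rightarrow> 'w)) arrangement \<Rightarrow>
    ('h \<times> nat, 'v \<times> (nat \<Rightarrow> 'w)) arrangement" where
  "polarization_step H P C =
     transport (case_sum id (\<lambda>i. (H, i))) push (parallel_connection C (H, 1) P 1)"

text \<open>
  The list gives the order in which the hyperplanes are processed, and \<open>P H\<close> is the
  arrangement attached at \<open>H\<close>.
\<close>

primrec polarize ::
  "('h \<Rightarrow> (nat, 'w) arrangement) \<Rightarrow> 'h list \<Rightarrow> ('h \<times> nat, 'v \<times> (nat \<Rightarrow> 'w)) arrangement \<Rightarrow>
    ('h \<times> nat, 'v \<times> (nat \<Rightarrow> 'w)) arrangement" where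
  "polarize P [] C = C"
| "polarize P (H # Hs) C = polarize P Hs (polarization_step H (P H) C)"

primrec theta_steps ::
  "('h \<Rightarrow> (nat, 'w::complex_vector) arrangement) \<Rightarrow> 'h list \<Rightarrow>
    ('h \<times> nat, 'v::complex_vector \<times> (nat \<Rightarrow> 'w)) arrangement \<Rightarrow>
    ('v \<times> (nat \<Rightarrow> 'w)) set \<Rightarrow> ('h \<Rightarrow> 'w set) \<Rightarrow> ('v \<times> (nat \<Rightarrow> 'w)) set" where
  "theta_steps P [] C u b = u"
| "theta_steps P (H # Hs) C u b =
     theta_steps P Hs (polarization_step H (P H) C)
       (push ` pc_map (form C (H, 1)) (form (P H) 1) u (b H)) b"

definition polarization ::
  "('h, 'v) arrangement \<Rightarrow> ('h \<Rightarrow> (nat, 'w::zero) arrangement) \<Rightarrow> 'h list \<Rightarrow>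
    ('h \<times> nat, 'v \<times> (nat \<Rightarrow> 'w)) arrangement" where
  "polarization A P Hs = polarize P Hs (polarization_start A)"

definition theta ::
  "('h, 'v::complex_vector) arrangement \<Rightarrow> ('h \<Rightarrow> (nat, 'w::complex_vector) arrangement) \<Rightarrow> 'h list \<Rightarrow>
    'v set \<Rightarrow> ('h \<Rightarrow> 'w set) \<Rightarrow> ('v \<times> (nat \<Rightarrow> 'w)) set" where
  "theta A P Hs u b = theta_steps P Hs (polarization_start A) (start ` u) b"

section \<open>Pullback squares\<close>

text \<open>
  The square with top \<open>f\<close>, left \<open>p\<close>, right \<open>q\<close> and bottom \<open>j\<close> commutes, and the induced
  map from \<open>X\<close> to the fiber product is a homeomorphism.
\<close>

definition pullback_square ::
  "'a topology \<Rightarrow> 'b topology \<Rightarrow> 'c topology \<Rightarrow> 'd topology \<Rightarrow>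
    ('a \<Rightarrow> 'b) \<Rightarrow> ('a \<Rightarrow> 'c) \<Rightarrow> ('b \<Rightarrow> 'd) \<Rightarrow> ('c \<Rightarrow> 'd) \<Rightarrow> bool" where
  "pullback_square X Y Z W f p q j \<longleftrightarrow>
     continuous_map X Y f \<and> continuous_map X Z p \<and> continuous_map Y W q \<and> continuous_map Z W j \<and>
     (\<forall>x\<in>topspace X. q (f x) = j (p x)) \<and>
     homeomorphic_map X
       (subtopology (prod_topology Z Y) {(z, y). j z = q y}) (\<lambda>x. (p x, f x))"

end

theory Submission
  imports Defs
begin

text \<open>
  The bottom map of the square lifts to an injective linear map of the surrounding vector spaces,
  and a suitable multiple of this lift is the top map.

  Choose in each base point \<open>b H\<close> a representative \<open>w\<close> at which the form of the basepoint line has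
  the value \<open>1\<close>. Then \<open>([v], [w]) \<mapsto> [(g(w) v, f(v) w)]\<close> is induced by \<open>v \<mapsto> (v, f(v) w)\<close>, which is
  linear in \<open>v\<close>. Composing over all hyperplanes gives a linear \<open>\<psi>\<close> with \<open>j [v] = [\<psi> v]\<close> and with
  \<open>fst (\<psi> v) = v\<close>. Along \<open>\<psi>\<close> the form of the original hyperplane \<open>H\<close> is unchanged, and the form of
  the \<open>i\<close>-th line attached at \<open>H\<close> pulls back to \<open>g\<^sub>i(w) f\<^sub>H\<close> with \<open>g\<^sub>i(w) \<noteq> 0\<close>, because \<open>b H\<close> avoids all
  the lines. This is the invariant \<open>polarization_lift\<close>, carried through the construction by
  \<open>polarization_lift_step\<close>.

  Consequently the defining polynomial of the polarization pulls back along \<open>\<psi>\<close> to a nonzero constant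
  \<open>c\<close> times \<open>\<Prod>\<^sub>H f\<^sub>H ^ m\<^sub>H\<close>. The latter is homogeneous of degree \<open>N > 0\<close>, so \<open>c\<close> is absorbed by an
  \<open>N\<close>-th root: with \<open>c l ^ N = 1\<close> the map \<open>\<Phi> v = \<psi> (l v)\<close> pulls one polynomial back to the
  other exactly. Equivariance is linearity of \<open>\<psi>\<close>.

  That the square is a pullback then holds for any such embedding
  (\<open>pullback_square_of_embedding\<close>): a point \<open>([v], y)\<close> of the fiber product satisfies
  \<open>y = a \<Phi> v = \<Phi> (a v)\<close> for a scalar \<open>a \<noteq> 0\<close>, and the inverse of \<open>x \<mapsto> ([x], \<Phi> x)\<close> is continuous
  since \<open>x\<close> is recovered from \<open>\<Phi> x\<close> by a linear projection.
\<close>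

section \<open>Projectivized complements\<close>

lemma proj_scaleC:
  assumes "a \<noteq> 0"
  shows "proj (a *\<^sub>C x) = proj x"
proof -
  have "\<exists>c'. c *\<^sub>C x = c' *\<^sub>C a *\<^sub>C x \<and> c' \<noteq> 0" if "c \<noteq> 0" for c
    using that assms by (intro exI[of _ "c / a"]) (simp add: scaleC_scaleC)
  moreover have "\<exists>c'. c *\<^sub>C a *\<^sub>C x = c' *\<^sub>C x \<and> c' \<noteq> 0" if "c \<noteq> 0" for c
    using that assms by (intro exI[of _ "c * a"]) (simp add: scaleC_scaleC)
  ultimately show ?thesis unfolding proj_def by blast
qed

lemma mem_proj_self: "x \<in> proj x"
  unfolding proj_def by (auto intro!: exI[of _ 1] simp: scaleC_one)

lemma proj_eqD:
  assumes "proj x = proj y"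
  obtains a where "a \<noteq> 0" "x = a *\<^sub>C y"
  using assms mem_proj_self[of x] unfolding proj_def by auto

lemma topspace_proj_space: "topspace (proj_space V) = proj ` (V - {0})"
  using quotient_imp_surjective_map[OF quotient_map_proj[of V]] by simp

lemma topspace_proj_compl:
  assumes "0 \<notin> compl_arr A"
  shows "topspace (proj_compl A) = proj ` compl_arr A"
  using assms by (auto simp: proj_compl_def topspace_proj_space compl_arr_def)

lemma continuous_map_proj_compl:
  assumes "0 \<notin> compl_arr A" "S \<subseteq> compl_arr A"
  shows "continuous_map (top_of_set S) (proj_compl A) proj"
proof -
  have "S \<subseteq> ambient A - {0}" using assms by (auto simp: compl_arr_def)
  moreover have "continuous_map (top_of_set (ambient A - {0})) (proj_space (ambient A)) proj"
    by (rule quotient_imp_continuous_map[OF quotient_map_proj])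
  ultimately have "continuous_map (top_of_set S) (proj_space (ambient A)) proj"
    by (metis continuous_map_from_subtopology_mono)
  then show ?thesis
    using assms by (auto simp: proj_compl_def continuous_map_in_subtopology)
qed

text \<open>
  Continuity descends along the quotient map from \<open>V - {0}\<close>. A map between complements can thus be
  treated as the restriction of a map between the full projective spaces.
\<close>

lemma continuous_map_proj_space:
  assumes "continuous_on (V - {0}) \<Phi>" "\<Phi> ` (V - {0}) \<subseteq> W - {0}"
    and "\<And>v. v \<in> V - {0} \<Longrightarrow> j (proj v) = proj (\<Phi> v)"
  shows "continuous_map (proj_space V) (proj_space W) j"
proof (rule continuous_compose_quotient_map[OF quotient_map_proj])
  have "continuous_map (top_of_set (V - {0})) (top_of_set (W - {0})) \<Phi>"
    using assms by (auto simp: continuous_map_in_subtopology)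
  then have "continuous_map (top_of_set (V - {0})) (proj_space W) (proj \<circ> \<Phi>)"
    by (rule continuous_map_compose[OF _ quotient_imp_continuous_map[OF quotient_map_proj]])
  then show "continuous_map (top_of_set (V - {0})) (proj_space W) (j \<circ> proj)"
    by (rule continuous_map_eq) (use assms(3) in auto)
qed

section \<open>Pullback squares from homogeneous embeddings\<close>

text \<open>
  Two classes in projective space agree exactly when the vectors differ by a nonzero scalar. Since
  \<open>\<Phi>\<close> is homogeneous, that scalar can be moved into its argument, so each point of the fiber
  product comes from a vector, and the retraction \<open>r\<close> makes this vector unique and dependent
  continuously on the point. The hypothesis on \<open>j\<close> includes vectors outside the complement, because
  the continuity of \<open>j\<close> is deduced on the whole projective space.
\<close>

lemma pullback_square_of_embedding:
  fixes A :: "('h, 'v::{complex_vector,topological_space}) arrangement"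
    and B :: "('k, 'u::{complex_vector,topological_space}) arrangement"
  assumes amb: "ambient A = UNIV" "range \<Phi> \<subseteq> ambient B"
    and cont: "continuous_on UNIV \<Phi>" "continuous_on UNIV r"
    and hom: "\<And>a v. \<Phi> (a *\<^sub>C v) = a *\<^sub>C \<Phi> v"
    and ret: "\<And>v. r (\<Phi> v) = v"
    and j: "\<And>v. j (proj v) = proj (\<Phi> v)"
    and fiber: "\<And>v. \<Phi> v \<in> milnor_fiber B k \<longleftrightarrow> v \<in> milnor_fiber A m"
    and compl: "\<Phi> ` compl_arr A \<subseteq> compl_arr B"
    and sub: "milnor_fiber A m \<subseteq> compl_arr A" "milnor_fiber B k \<subseteq> compl_arr B"
    and zero: "0 \<notin> compl_arr A" "0 \<notin> compl_arr B"
  shows "pullback_square (top_of_set (milnor_fiber A m)) (top_of_set (milnor_fiber B k))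
    (proj_compl A) (proj_compl B) \<Phi> proj proj j"
proof -
  let ?X = "top_of_set (milnor_fiber A m)" and ?Y = "top_of_set (milnor_fiber B k)"
  let ?F = "subtopology (prod_topology (proj_compl A) ?Y) {(z, y). j z = proj y}"
  have \<Phi>0: "\<Phi> 0 = 0"
    using hom[of 0 0] by simp
  have \<Phi>: "continuous_map ?X ?Y \<Phi>"
    using fiber by (auto simp: continuous_map_in_subtopology intro: continuous_on_subset[OF cont(1)])
  have p: "continuous_map ?X (proj_compl A) proj" "continuous_map ?Y (proj_compl B) proj"
    using continuous_map_proj_compl sub zero by blast+
  have "\<Phi> v \<noteq> 0" if "v \<noteq> 0" for v
    using that ret[of v] ret[of 0] \<Phi>0 by metis
  then have "continuous_map (proj_space (ambient A)) (proj_space (ambient B)) j"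
    using amb j by (intro continuous_map_proj_space[of _ \<Phi>] continuous_on_subset[OF cont(1)]) auto
  then have jc: "continuous_map (proj_compl A) (proj_compl B) j"
    using compl j unfolding proj_compl_def
    by (auto simp: continuous_map_in_subtopology intro!: continuous_map_from_subtopology)
  have "homeomorphic_maps ?X ?F (\<lambda>x. (proj x, \<Phi> x)) (\<lambda>(z, y). r y)"
    unfolding homeomorphic_maps_def
  proof (intro conjI ballI)
    show "continuous_map ?X ?F (\<lambda>x. (proj x, \<Phi> x))"
      using p \<Phi> j by (auto simp: continuous_map_in_subtopology continuous_map_paired)
    \<comment> \<open>Surjectivity onto the fiber product; the lift is then identified as \<open>r y\<close>.\<close>
    have lift: "\<exists>x \<in> milnor_fiber A m. z = proj x \<and> y = \<Phi> x" if "(z, y) \<in> topspace ?F" for z y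
    proof -
      have y: "y \<in> milnor_fiber B k" "j z = proj y" and "z \<in> topspace (proj_compl A)"
        using that by auto
      then obtain v where v: "z = proj v"
        using topspace_proj_compl[OF zero(1)] by auto
      then have "proj y = proj (\<Phi> v)"
        using j y by simp
      then obtain a where "a \<noteq> 0" "y = a *\<^sub>C \<Phi> v"
        by (rule proj_eqD)
      then have "y = \<Phi> (a *\<^sub>C v)"
        by (simp add: hom)
      moreover have "z = proj (a *\<^sub>C v)"
        using v \<open>a \<noteq> 0\<close> by (simp add: proj_scaleC)
      ultimately show ?thesis
        using y(1) fiber by blast
    qed
    show "(case (proj x, \<Phi> x) of (z, y) \<Rightarrow> r y) = x" for x
      by (simp add: ret)
    show "(proj (case q of (z, y) \<Rightarrow> r y), \<Phi> (case q of (z, y) \<Rightarrow> r y)) = q"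
      if "q \<in> topspace ?F" for q
      using lift[of "fst q" "snd q"] that by (auto simp: ret)
    have "continuous_map ?F euclidean (r \<circ> snd)"
    proof (rule continuous_map_compose)
      show "continuous_map ?F ?Y snd"
        by (simp add: continuous_map_from_subtopology continuous_map_snd)
      show "continuous_map ?Y euclidean r"
        using continuous_on_subset[OF cont(2)] by simp
    qed
    moreover have "r y \<in> milnor_fiber A m" if "(z, y) \<in> topspace ?F" for z y
      using lift[OF that] ret by auto
    ultimately show "continuous_map ?F ?X (\<lambda>(z, y). r y)"
      by (auto simp: continuous_map_in_subtopology o_def case_prod_unfold)
  qed
  then have "homeomorphic_map ?X ?F (\<lambda>x. (proj x, \<Phi> x))"
    by (rule homeomorphic_maps_imp_map)
  then show ?thesis
    unfolding pullback_square_def using \<Phi> p jc j by auto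
qed

lemma milnor_fiber_subset_compl_arr:
  assumes "finite (hyps A)" "\<And>H. H \<in> hyps A \<Longrightarrow> 0 < m H"
  shows "milnor_fiber A m \<subseteq> compl_arr A"
proof
  fix v assume "v \<in> milnor_fiber A m"
  then have v: "v \<in> ambient A" "(\<Prod>H\<in>hyps A. form A H v ^ m H) \<noteq> 0"
    by (auto simp: milnor_fiber_def)
  then have "form A H v \<noteq> 0" if "H \<in> hyps A" for H
    using assms that by (force simp: prod_zero_iff)
  with v show "v \<in> compl_arr A"
    by (simp add: compl_arr_def)
qed

section \<open>Linear forms and coordinate maps\<close>

lemma form_scaleC:
  assumes "is_arrangement A" "H \<in> hyps A"
  shows "form A H (a *\<^sub>C v) = a * form A H v"
proof -
  interpret Vector_Spaces.linear "(*\<^sub>C)" "(*)" "form A H"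
    using assms by (simp add: is_arrangement_def)
  show ?thesis by (rule scale)
qed

lemma continuous_on_form:
  fixes A :: "('h, complex ^ 'n) arrangement"
  assumes "is_arrangement A" "H \<in> hyps A"
  shows "continuous_on S (form A H)"
proof -
  interpret Vector_Spaces.linear "(*\<^sub>C)" "(*)" "form A H"
    using assms by (simp add: is_arrangement_def)
  have "r *\<^sub>R v = complex_of_real r *\<^sub>C v" for r and v :: "complex ^ 'n"
    by (simp add: vec_eq_iff scaleC_vec_def scaleC_complex_def scaleR_conv_of_real[where ?'a = complex])
  then have "Real_Vector_Spaces.linear (form A H)"
    by (intro Real_Vector_Spaces.linearI) (simp_all add: add scale scaleR_conv_of_real)
  then show ?thesis
    by (simp add: linear_continuous_on linear_conv_bounded_linear)
qed

lemma inv_push: "inv push (push p) = p"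
proof (rule inv_f_f, rule injI)
  fix p q :: "('a \<times> (nat \<Rightarrow> 'b)) \<times> 'b"
  assume eq: "push p = push q"
  obtain v s w v' s' w' where pq: "p = ((v, s), w)" "q = ((v', s'), w')"
    by (metis surj_pair)
  have eqs: "v = v'" "case_nat w s = case_nat w' s'"
    using eq by (auto simp: push_def pq)
  have "w = w'"
    using fun_cong[OF eqs(2), of 0] by simp
  moreover have "s i = s' i" for i
    using fun_cong[OF eqs(2), of "Suc i"] by simp
  ultimately have "w = w'" "s = s'"
    by auto
  with eqs(1) show "p = q" by (simp add: pq)
qed

lemma inv_start: "inv start (start v) = v"
  by (rule inv_f_f) (auto simp: inj_def start_def)

lemma push_scaleC: "push (a *\<^sub>C p) = a *\<^sub>C push p"
  by (auto simp: push_def scaleC_prod_def scaleC_fun_def split: prod.splits nat.splits)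

lemma fst_push [simp]: "fst (push (x, w)) = fst x"
  by (simp add: push_def split: prod.splits)

lemma continuous_on_push:
  assumes "continuous_on S f" "continuous_on S h"
  shows "continuous_on S (\<lambda>v. push (f v, h v))"
proof -
  have "continuous_on S (\<lambda>v. case_nat (h v) (snd (f v)) i)" for i
    using assms continuous_on_product_then_coordinatewise[of S "\<lambda>v. snd (f v)"]
    by (cases i) (auto intro: continuous_intros)
  then have "continuous_on S (\<lambda>v. case_nat (h v) (snd (f v)))"
    by (rule continuous_on_coordinatewise_then_product)
  then show ?thesis
    unfolding push_def case_prod_unfold using assms by (auto intro!: continuous_intros)
qed

lemma push_image_proj: "push ` proj p = proj (push p)"
  by (auto simp: proj_def push_scaleC[symmetric])

lemma start_image_proj: "start ` proj v = proj (start v :: 'v::complex_vector \<times> (nat \<Rightarrow> 'w::complex_vector))"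
proof -
  have "a *\<^sub>C (start v :: 'v \<times> (nat \<Rightarrow> 'w)) = start (a *\<^sub>C v)" for a
    by (simp add: start_def scaleC_prod_def scaleC_fun_def)
  then show ?thesis by (auto simp: proj_def)
qed

section \<open>Lifting the base point inclusion\<close>

text \<open>
  The value \<open>1\<close> at the basepoint line makes the first component \<open>g(w) v\<close> of the parallel connection
  map equal to \<open>v\<close>. Homogeneity of the forms and membership in the ambient space are recorded only
  along the line through \<open>w\<close>, where the lift takes its values.
\<close>

definition normalized_point :: "(nat, 'w::complex_vector) arrangement \<Rightarrow> 'w \<Rightarrow> bool" where
  "normalized_point P w \<longleftrightarrow>
     1 \<in> hyps P \<and> form P 1 w = 1 \<and> (\<forall>a. a *\<^sub>C w \<in> ambient P) \<and>
     (\<forall>i\<in>hyps P. form P i w \<noteq> 0 \<and> (\<forall>a. form P i (a *\<^sub>C w) = a * form P i w))"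

text \<open>
  A base point lies off the basepoint line, so any of its representatives can be divided by its value
  there.
\<close>

lemma normalized_point_pencil:
  assumes arr: "is_arrangement (pencil k g)" and "1 \<le> k"
    and q: "q \<in> topspace (proj_compl (pencil k g))"
  obtains w where "normalized_point (pencil k g) w" "q = proj w"
proof -
  let ?P = "pencil k g"
  have hom: "form ?P i (a *\<^sub>C w) = a * form ?P i w" if "i \<in> hyps ?P" for i a w
    using form_scaleC[OF arr that] .
  have one: "1 \<in> hyps ?P" using \<open>1 \<le> k\<close> by (simp add: pencil_def)
  obtain x where x: "x \<in> compl_arr ?P" "q = proj x"
    using q by (auto simp: proj_compl_def)
  then have nz: "form ?P i x \<noteq> 0" if "i \<in> hyps ?P" for i
    using that by (simp add: compl_arr_def)
  have amb: "a *\<^sub>C x \<in> ambient ?P" for a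
    using x by (auto simp: compl_arr_def pencil_def scaleC_prod_def scaleC_complex_def)
  define w where "w = (1 / form ?P 1 x) *\<^sub>C x"
  have "normalized_point ?P w"
    unfolding normalized_point_def w_def
    using one nz[OF one] nz amb by (auto simp: hom scaleC_scaleC)
  moreover have "q = proj w"
    unfolding w_def x(2) using nz[OF one] by (simp add: proj_scaleC)
  ultimately show ?thesis by (rule that)
qed

text \<open>
  \<open>C\<close> is an intermediate stage of the polarization of \<open>A\<close>. For the labels \<open>(H, 1)\<close> the constant
  must be \<open>1\<close>: these forms enter the next parallel connection, whose map would otherwise not have the
  lift \<open>v \<mapsto> (\<psi> v, f\<^sub>H(v) w)\<close>.
\<close>

definition polarization_lift ::
  "('h, 'v::{complex_vector,topological_space}) arrangement \<Rightarrow>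
    ('h \<times> nat, 'v \<times> (nat \<Rightarrow> 'w)) arrangement \<Rightarrow>
    ('v \<Rightarrow> 'v \<times> (nat \<Rightarrow> 'w::{complex_vector,topological_space})) \<Rightarrow> bool" where
  "polarization_lift A C \<psi> \<longleftrightarrow>
     continuous_on UNIV \<psi> \<and> (\<forall>a v. \<psi> (a *\<^sub>C v) = a *\<^sub>C \<psi> v) \<and>
     (\<forall>v. fst (\<psi> v) = v) \<and> range \<psi> \<subseteq> ambient C \<and>
     (\<forall>H\<in>hyps A. (H, 1) \<in> hyps C \<and> (\<forall>v. form C (H, 1) (\<psi> v) = form A H v)) \<and>
     (\<forall>(H, i)\<in>hyps C. \<exists>c. c \<noteq> 0 \<and> (\<forall>v. form C (H, i) (\<psi> v) = c * form A H v))"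

lemma polarization_lift_start:
  fixes A :: "('h, 'v::{complex_vector,topological_space}) arrangement"
  assumes "ambient A = UNIV"
  shows "polarization_lift A (polarization_start A)
    (start :: 'v \<Rightarrow> 'v \<times> (nat \<Rightarrow> 'c::{complex_vector,topological_space}))"
proof -
  have "inv_into (hyps A) (\<lambda>H. (H, 1::nat)) (H, 1) = H" if "H \<in> hyps A" for H
    using that by (intro inv_into_f_eq inj_onI) auto
  then have form: "form (polarization_start A) (H, 1) (start v) = form A H v" if "H \<in> hyps A" for H v
    using that by (simp add: polarization_start_def transport_def inv_start)
  have "\<exists>c. c \<noteq> 0 \<and> (\<forall>v. form (polarization_start A) (H, i) (start v) = c * form A H v)"
    if "(H, i) \<in> hyps (polarization_start A)" for H i
    using that form[of H] by (intro exI[of _ 1]) (auto simp: polarization_start_def transport_def)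
  moreover have "continuous_on UNIV (start :: 'v \<Rightarrow> 'v \<times> (nat \<Rightarrow> 'c))"
    unfolding start_def[abs_def] by (intro continuous_intros)
  ultimately show ?thesis
    unfolding polarization_lift_def using assms form
    by (auto simp: polarization_start_def transport_def start_def scaleC_prod_def scaleC_fun_def)
qed

lemma hyps_polarization_step:
  "hyps (polarization_step H P C) = hyps C \<union> {H} \<times> (hyps P - {1})"
  by (auto simp: polarization_step_def transport_def parallel_connection_def image_Un image_image)

text \<open>
  Transport reads labels through an inverse of the relabelling, so the new labels must not collide
  with the old ones.
\<close>

lemma form_polarization_step:
  assumes "\<And>i. i \<in> hyps P - {1} \<Longrightarrow> (H, i) \<notin> hyps C"
  shows "L \<in> hyps C \<Longrightarrow> form (polarization_step H P C) L (push (x, y)) = form C L x"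
    and "i \<in> hyps P - {1} \<Longrightarrow> form (polarization_step H P C) (H, i) (push (x, y)) = form P i y"
proof -
  let ?\<sigma> = "case_sum id (Pair H)" and ?S = "Inl ` hyps C \<union> Inr ` (hyps P - {1})"
  have inj: "inj_on ?\<sigma> ?S"
    using assms by (force simp: inj_on_def)
  show "form (polarization_step H P C) L (push (x, y)) = form C L x" if "L \<in> hyps C"
    using that inv_into_f_eq[OF inj, of "Inl L" L]
    by (simp add: polarization_step_def transport_def parallel_connection_def inv_push)
  show "form (polarization_step H P C) (H, i) (push (x, y)) = form P i y" if "i \<in> hyps P - {1}"
    using that inv_into_f_eq[OF inj, of "Inr i" "(H, i)"]
    by (simp add: polarization_step_def transport_def parallel_connection_def inv_push)
qed

text \<open>
  The pair \<open>(\<psi> v, f\<^sub>H(v) w)\<close> satisfies the equation of the parallel connection because the basepoint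
  form takes the value \<open>f\<^sub>H(v)\<close> on \<open>f\<^sub>H(v) w\<close>. The new constants are the values at \<open>w\<close> of the forms of
  the attached lines.
\<close>

lemma polarization_lift_step:
  fixes P :: "(nat, complex \<times> complex) arrangement"
  assumes lift: "polarization_lift A C \<psi>" and H: "H \<in> hyps A"
    and new: "\<And>i. i \<in> hyps P - {1} \<Longrightarrow> (H, i) \<notin> hyps C"
    and w: "normalized_point P w"
    and f: "continuous_on UNIV (form A H)" "\<And>a v. form A H (a *\<^sub>C v) = a * form A H v"
  shows "polarization_lift A (polarization_step H P C) (\<lambda>v. push (\<psi> v, form A H v *\<^sub>C w))"
    (is "polarization_lift A ?C ?\<psi>")
proof -
  note form = form_polarization_step[OF new]
  have \<psi>: "continuous_on UNIV \<psi>" "\<And>a v. \<psi> (a *\<^sub>C v) = a *\<^sub>C \<psi> v" "\<And>v. fst (\<psi> v) = v"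
    "\<And>v. \<psi> v \<in> ambient C" "\<And>K. K \<in> hyps A \<Longrightarrow> (K, 1) \<in> hyps C"
    "\<And>K v. K \<in> hyps A \<Longrightarrow> form C (K, 1) (\<psi> v) = form A K v"
    "\<And>K i. (K, i) \<in> hyps C \<Longrightarrow> \<exists>c. c \<noteq> 0 \<and> (\<forall>v. form C (K, i) (\<psi> v) = c * form A K v)"
    using lift by (auto simp: polarization_lift_def)
  have w: "1 \<in> hyps P" "form P 1 w = 1" "\<And>a. a *\<^sub>C w \<in> ambient P"
    "\<And>i. i \<in> hyps P \<Longrightarrow> form P i w \<noteq> 0"
    "\<And>i a. i \<in> hyps P \<Longrightarrow> form P i (a *\<^sub>C w) = a * form P i w"
    using w by (auto simp: normalized_point_def)
  have "continuous_on UNIV (\<lambda>v. form A H v *\<^sub>C w)"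
    unfolding scaleC_prod_def scaleC_complex_def by (intro continuous_intros f)
  then have "continuous_on UNIV ?\<psi>"
    by (rule continuous_on_push[OF \<psi>(1)])
  moreover have "?\<psi> (a *\<^sub>C v) = a *\<^sub>C ?\<psi> v" for a v
    unfolding push_scaleC[symmetric] by (simp add: \<psi>(2) f scaleC_prod_def[of a "(_, _)"] scaleC_scaleC)
  moreover have "?\<psi> v \<in> ambient ?C" for v
    using \<psi> w H by (auto simp: polarization_step_def transport_def parallel_connection_def)
  moreover have "(K, 1) \<in> hyps ?C" "form ?C (K, 1) (?\<psi> v) = form A K v" if "K \<in> hyps A" for K v
    using \<psi>(5,6)[OF that] form(1) by (auto simp: hyps_polarization_step)
  moreover have "\<exists>c. c \<noteq> 0 \<and> (\<forall>v. form ?C (K, i) (?\<psi> v) = c * form A K v)"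
    if "(K, i) \<in> hyps ?C" for K i
  proof (cases "(K, i) \<in> hyps C")
    case True
    then show ?thesis using \<psi>(7)[OF True] form(1)[OF _ True] by simp
  next
    case False
    then have i: "K = H" "i \<in> hyps P - {1}"
      using that by (auto simp: hyps_polarization_step)
    then show ?thesis
      using w(4,5) form(2) by (intro exI[of _ "form P i w"]) auto
  qed
  ultimately show ?thesis
    unfolding polarization_lift_def by (auto simp: \<psi>(3))
qed

lemma hyps_polarize:
  "hyps (polarize P Hs C) = hyps C \<union> (SIGMA H:set Hs. hyps (P H) - {1})"
  by (induction Hs arbitrary: C) (auto simp: hyps_polarization_step)

text \<open>
  The induction runs along the list of hyperplanes still to be processed. At each of these only the
  label \<open>(H, 1)\<close> has appeared, which keeps the labels of later steps apart.
\<close>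

lemma polarization_lift_polarize:
  fixes P :: "'h \<Rightarrow> (nat, complex \<times> complex) arrangement"
  assumes "polarization_lift A C \<psi>" "distinct Hs" "set Hs \<subseteq> hyps A"
    and "\<And>H i. H \<in> set Hs \<Longrightarrow> (H, i) \<in> hyps C \<Longrightarrow> i = 1"
    and "\<And>H. H \<in> set Hs \<Longrightarrow> \<exists>w. normalized_point (P H) w \<and> b H = proj w"
    and f: "\<And>H. H \<in> hyps A \<Longrightarrow> continuous_on UNIV (form A H)"
      "\<And>H a v. H \<in> hyps A \<Longrightarrow> form A H (a *\<^sub>C v) = a * form A H v"
  shows "\<exists>\<psi>'. polarization_lift A (polarize P Hs C) \<psi>' \<and>
    (\<forall>v. theta_steps P Hs C (proj (\<psi> v)) b = proj (\<psi>' v))"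
  using assms(1-5)
proof (induction Hs arbitrary: C \<psi>)
  case Nil
  then show ?case by auto
next
  case (Cons H Hs)
  let ?C = "polarization_step H (P H) C"
  obtain w where w: "normalized_point (P H) w" "b H = proj w"
    using Cons.prems(5)[of H] by auto
  let ?\<psi> = "\<lambda>v. push (\<psi> v, form A H v *\<^sub>C w)"
  have H: "H \<in> hyps A" using Cons.prems by simp
  have "polarization_lift A ?C ?\<psi>"
    using Cons.prems(1) H _ w(1) f[OF H]
    by (rule polarization_lift_step) (use Cons.prems(4) in auto)
  moreover have "i = 1" if "K \<in> set Hs" "(K, i) \<in> hyps ?C" for K i
    using that Cons.prems(2,4) by (auto simp: hyps_polarization_step)
  ultimately obtain \<psi>' where \<psi>': "polarization_lift A (polarize P Hs ?C) \<psi>'"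
    "\<And>v. theta_steps P Hs ?C (proj (?\<psi> v)) b = proj (\<psi>' v)"
    using Cons.IH[of ?C ?\<psi>] Cons.prems by auto
  have "push ` pc_map (form C (H, 1)) (form (P H) 1) (proj (\<psi> v)) (b H) = proj (?\<psi> v)" for v
  proof -
    have form: "form C (H, 1) (\<psi> v) = form A H v" for v
      using Cons.prems(1) H by (simp add: polarization_lift_def)
    have "form C (H, 1) (a *\<^sub>C \<psi> v) = a * form C (H, 1) (\<psi> v)" for a
      using Cons.prems(1) form[of "a *\<^sub>C v"] form[of v] f(2)[OF H, of a v]
      by (simp add: polarization_lift_def)
    moreover have "form (P H) 1 (a *\<^sub>C w) = a * form (P H) 1 w" "form (P H) 1 w = 1" for a
      using w(1) by (auto simp: normalized_point_def)
    ultimately have "pc_map (form C (H, 1)) (form (P H) 1) (proj (\<psi> v)) (b H) =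
        proj (\<psi> v, form A H v *\<^sub>C w)"
      unfolding w(2) by (subst pc_map_proj) (simp_all add: form[simplified] scaleC_one)
    then show ?thesis
      by (simp add: push_image_proj)
  qed
  with \<psi>' show ?case by auto
qed

section \<open>The pullback square of Milnor covers\<close>

theorem lemma8p4:
  fixes A :: "('h, complex ^ 'n) arrangement"
    and m :: "'h \<Rightarrow> nat"
    and g :: "nat \<Rightarrow> nat \<Rightarrow> complex \<times> complex \<Rightarrow> complex"
    and Hs :: "'h list"
    and b :: "'h \<Rightarrow> (complex \<times> complex) set"
  defines "P \<equiv> \<lambda>H. pencil (m H) (g (m H))"
  defines "B \<equiv> polarization A P Hs"
  defines "j \<equiv> \<lambda>u. theta A P Hs u b"
  defines "N \<equiv> \<Sum>H\<in>hyps A. m H"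
  assumes "ambient A = UNIV"
    and "is_multiarrangement A m"
    and "\<And>k. 1 \<le> k \<Longrightarrow> is_arrangement (pencil k (g k))"
    and "distinct Hs" and "set Hs = hyps A"
    and "\<And>H. H \<in> hyps A \<Longrightarrow> b H \<in> topspace (proj_compl (P H))"
  shows "\<exists>\<Phi>.
    pullback_square (top_of_set (milnor_fiber A m)) (top_of_set (milnor_fiber B (\<lambda>_. 1)))
      (proj_compl A) (proj_compl B) \<Phi> proj proj j \<and>
    (\<forall>\<zeta> z. \<zeta> ^ N = 1 \<longrightarrow> z \<in> milnor_fiber A m \<longrightarrow> \<Phi> (\<zeta> *\<^sub>C z) = \<zeta> *\<^sub>C \<Phi> z)"
proof -
  have arr: "is_arrangement A" and mpos: "\<And>H. H \<in> hyps A \<Longrightarrow> 0 < m H"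
    and gcd: "Gcd (m ` hyps A) = 1"
    using \<open>is_multiarrangement A m\<close> by (auto simp: is_multiarrangement_def)
  have fin: "finite (hyps A)" using arr by (simp add: is_arrangement_def)
  \<comment> \<open>The gcd of the empty family is \<open>0\<close>, so there is a hyperplane; it gives both \<open>N > 0\<close> and
    \<open>0 \<notin> compl_arr A\<close>.\<close>
  obtain H\<^sub>0 where H\<^sub>0: "H\<^sub>0 \<in> hyps A" using gcd by fastforce
  have "N > 0"
    unfolding N_def using sum_pos2[OF fin H\<^sub>0, of m] mpos[OF H\<^sub>0] by simp
  have hom: "form A H (a *\<^sub>C v) = a * form A H v" if "H \<in> hyps A" for H a v
    using form_scaleC[OF arr that] .
  have "\<exists>w. normalized_point (P H) w \<and> b H = proj w" if "H \<in> set Hs" for H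
  proof -
    have "H \<in> hyps A" "1 \<le> m H" using that \<open>set Hs = hyps A\<close> mpos[of H] by auto
    then show ?thesis
      using normalized_point_pencil[of "m H" "g (m H)" "b H"] assms(7,10) unfolding P_def by metis
  qed
  moreover have "i = 1" if "(H, i) \<in> hyps (polarization_start A)" for H i
    using that by (auto simp: polarization_start_def transport_def)
  ultimately have "\<exists>\<psi>. polarization_lift A B \<psi> \<and> (\<forall>v. j (proj v) = proj (\<psi> v))"
    unfolding B_def j_def polarization_def theta_def start_image_proj
    using assms(8,9) hom continuous_on_form[OF arr] polarization_lift_start[OF \<open>ambient A = UNIV\<close>]
    by (intro polarization_lift_polarize) auto
  then obtain \<psi> where lift: "polarization_lift A B \<psi>" and j: "\<And>v. j (proj v) = proj (\<psi> v)"
    by blast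
  have \<psi>: "continuous_on UNIV \<psi>" "\<And>a v. \<psi> (a *\<^sub>C v) = a *\<^sub>C \<psi> v" "\<And>v. fst (\<psi> v) = v"
    "range \<psi> \<subseteq> ambient B"
    using lift by (auto simp: polarization_lift_def)
  have hB: "hyps B = (SIGMA H:hyps A. {1..m H})"
    using mpos \<open>set Hs = hyps A\<close>
    by (force simp: B_def polarization_def hyps_polarize polarization_start_def transport_def
      P_def pencil_def Suc_le_eq)
  have "\<forall>L\<in>hyps B. \<exists>c. c \<noteq> 0 \<and> (\<forall>v. form B L (\<psi> v) = c * form A (fst L) v)"
    using lift unfolding polarization_lift_def by fastforce
  then obtain c where c: "\<And>L. L \<in> hyps B \<Longrightarrow> c L \<noteq> 0"
    and form: "\<And>L v. L \<in> hyps B \<Longrightarrow> form B L (\<psi> v) = c L * form A (fst L) v"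
    by metis
  have finB: "finite (hyps B)" using fin by (simp add: hB)
  have defpoly: "(\<Prod>L\<in>hyps B. form B L (\<psi> v)) = prod c (hyps B) * (\<Prod>H\<in>hyps A. form A H v ^ m H)"
    for v
  proof -
    have "(\<Prod>L\<in>hyps B. form B L (\<psi> v)) = prod c (hyps B) * (\<Prod>L\<in>hyps B. form A (fst L) v)"
      by (simp add: form prod.distrib)
    also have "(\<Prod>L\<in>hyps B. form A (fst L) v) = (\<Prod>H\<in>hyps A. \<Prod>i\<in>{1..m H}. form A H v)"
      unfolding hB by (subst prod.Sigma[OF fin]) (auto simp: case_prod_unfold)
    finally show ?thesis by simp
  qed
  \<comment> \<open>The constant is absorbed by rescaling with an \<open>N\<close>-th root of its inverse.\<close>
  have "prod c (hyps B) \<noteq> 0" using c finB by (simp add: prod_zero_iff)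
  moreover from this obtain l where l: "l ^ N = inverse (prod c (hyps B))"
    using card_nth_roots[of "inverse (prod c (hyps B))" N] \<open>N > 0\<close> by fastforce
  ultimately have l1: "prod c (hyps B) * l ^ N = 1" and "l \<noteq> 0"
    using \<open>N > 0\<close> by (auto simp: power_0_left)
  let ?\<Phi> = "\<lambda>v. \<psi> (l *\<^sub>C v)"
  have scale: "continuous_on UNIV (\<lambda>v :: complex ^ 'n. a *\<^sub>C v)" for a
    unfolding scaleC_vec_def scaleC_complex_def by (intro continuous_intros)
  have "pullback_square (top_of_set (milnor_fiber A m)) (top_of_set (milnor_fiber B (\<lambda>_. 1)))
      (proj_compl A) (proj_compl B) ?\<Phi> proj proj j"
  proof (rule pullback_square_of_embedding[where r = "\<lambda>y. (1 / l) *\<^sub>C fst y"])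
    show "ambient A = UNIV" "range ?\<Phi> \<subseteq> ambient B"
      using assms(5) \<psi>(4) by auto
    show "continuous_on UNIV ?\<Phi>"
      using continuous_on_compose2[OF \<psi>(1) scale] by simp
    show "continuous_on UNIV (\<lambda>y :: (complex ^ 'n) \<times> (nat \<Rightarrow> complex \<times> complex). (1 / l) *\<^sub>C fst y)"
      by (rule continuous_on_compose2[OF scale continuous_on_fst[OF continuous_on_id]]) simp
    show "?\<Phi> (a *\<^sub>C v) = a *\<^sub>C ?\<Phi> v" for a v
      by (simp add: \<psi>(2) scaleC_scaleC mult.commute)
    show "(1 / l) *\<^sub>C fst (?\<Phi> v) = v" for v
      using \<open>l \<noteq> 0\<close> by (simp add: \<psi>(3) scaleC_scaleC scaleC_one)
    show "j (proj v) = proj (?\<Phi> v)" for v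
      using \<open>l \<noteq> 0\<close> by (simp add: j \<psi>(2) proj_scaleC)
    have "(\<Prod>L\<in>hyps B. form B L (?\<Phi> v)) = (\<Prod>H\<in>hyps A. form A H v ^ m H)" for v
    proof -
      have "(\<Prod>H\<in>hyps A. form A H (l *\<^sub>C v) ^ m H) = l ^ N * (\<Prod>H\<in>hyps A. form A H v ^ m H)"
        by (simp add: hom power_mult_distrib prod.distrib power_sum N_def)
      then show ?thesis
        using l1 by (simp add: defpoly flip: mult.assoc)
    qed
    then show "?\<Phi> v \<in> milnor_fiber B (\<lambda>_. 1) \<longleftrightarrow> v \<in> milnor_fiber A m" for v
      using \<psi>(4) assms(5) by (auto simp: milnor_fiber_def)
    show "?\<Phi> ` compl_arr A \<subseteq> compl_arr B"
      using \<psi>(4) c \<open>l \<noteq> 0\<close> hB hom by (auto simp: compl_arr_def form)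
    show "milnor_fiber A m \<subseteq> compl_arr A" "milnor_fiber B (\<lambda>_. 1) \<subseteq> compl_arr B"
      by (rule milnor_fiber_subset_compl_arr; use fin finB mpos in simp)+
    have zero: "form A H\<^sub>0 0 = 0" "\<psi> 0 = 0"
      using hom[OF H\<^sub>0, of 0 0] \<psi>(2)[of 0 0] by auto
    show "0 \<notin> compl_arr A"
      using zero H\<^sub>0 by (auto simp: compl_arr_def)
    have "(H\<^sub>0, 1) \<in> hyps B"
      using H\<^sub>0 mpos[OF H\<^sub>0] by (simp add: hB Suc_le_eq)
    then show "0 \<notin> compl_arr B"
      using form[of "(H\<^sub>0, 1)" 0] zero by (auto simp: compl_arr_def)
  qed
  moreover have "?\<Phi> (\<zeta> *\<^sub>C z) = \<zeta> *\<^sub>C ?\<Phi> z" for \<zeta> z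
    by (simp add: \<psi>(2) scaleC_scaleC mult.commute)
  ultimately show ?thesis by blast
qed

end
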